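(* Let $\Bbbk$ be a field. The ideal $I=\langle x^2y-xy^2,\ x^3,\ y^3\rangle\subset\Bbbk[x,y]$ cannot be expressed as an intersection of binomial irreducible ideals of $\Bbbk[x,y]$.
   Context: A binomial in $\Bbbk[x,y]$ is an element of the form $m-\lambda m'$ with $m,m'$ monomials and $\lambda\in\Bbbk$ (possibly $\lambda=0$). An ideal is binomial if it can be generated by binomials. An ideal is irreducible if it is not expressible as an intersection of two ideals properly containing it. *)

theory Defs
  imports "HOL-Algebra.Algebraic_Closure_Type"
begin

text \<open>
  The ring \<open>k[x,y]\<close> is the iterated polynomial ring \<open>k[x][y]\<close>, i.e. the type \<open>'a poly poly\<close>
  over a field \<open>'a\<close>: \<open>x\<close> is the inner variable and \<open>y\<close> the outer one. It is turned into a
  ring record so that the ideals of \<open>HOL-Algebra\<close> apply to it.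
\<close>

definition kxy :: "'a::field poly poly ring"
  where "kxy = ring_of_type_algebra"

definition var_x :: "'a::field poly poly"
  where "var_x = [:[:0, 1:]:]"

definition var_y :: "'a::field poly poly"
  where "var_y = [:0, 1:]"

definition monomials :: "'a::field poly poly set"
  where "monomials = {var_x ^ i * var_y ^ j |i j. True}"

text \<open>The constant \<open>c\<close> may be zero, and the two monomials may coincide.\<close>

definition binomials :: "'a::field poly poly set"
  where "binomials = {m - [:[:c:]:] * m' |m m' c. m \<in> monomials \<and> m' \<in> monomials}"

definition binomial_ideal :: "'a::field poly poly set \<Rightarrow> bool"
  where "binomial_ideal I \<longleftrightarrow> (\<exists>B \<subseteq> binomials. I = Idl\<^bsub>kxy\<^esub> B)"

text \<open>
  Read literally, the unit ideal is irreducible, since no ideal properly contains it; it is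
  irrelevant as a component of an intersection.
\<close>

definition irreducible_ideal :: "('a, 'b) ring_scheme \<Rightarrow> 'a set \<Rightarrow> bool"
  where "irreducible_ideal R I \<longleftrightarrow>
    ideal I R \<and> \<not> (\<exists>J K. ideal J R \<and> ideal K R \<and> I \<subset> J \<and> I \<subset> K \<and> I = J \<inter> K)"

end

theory Submission
  imports Defs
begin

text \<open>
  Write \<open>s = x\<^sup>2y\<close>. Modulo \<open>I\<close> every polynomial without terms of degree at most 2 is a scalar multiple
  of \<open>s\<close>, and \<open>s \<notin> I\<close>. If \<open>J \<supseteq> I\<close> is a binomial ideal with \<open>s \<notin> J\<close>, multiplying a binomial of \<open>J\<close> by
  \<open>x\<^sup>2y\<close>, then \<open>xy\<close>, \<open>x\<^sup>2\<close>, \<open>y\<^sup>2\<close>, then \<open>x\<close>, \<open>y\<close> turns its lowest terms into a multiple of \<open>s\<close>, and shows that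
  its part of degree at most 2 is a multiple of \<open>x\<^sup>2 - xy + y\<^sup>2\<close>, hence zero since a binomial has at
  most two terms. So \<open>J \<subseteq> I + \<langle>s\<rangle>\<close>, which forces \<open>J = I\<close>. But
  \<open>I = (I + \<langle>s\<rangle>) \<inter> (I + \<langle>x\<^sup>2 - xy + y\<^sup>2\<rangle>)\<close> is not irreducible. Hence \<open>s\<close> lies in every binomial
  irreducible ideal containing \<open>I\<close>.
\<close>

lemma ring_kxy: "ring kxy"
  unfolding kxy_def by (rule ring_from_type_algebra)

lemma kxy_sel [simp]:
  "carrier kxy = UNIV" "monoid.mult kxy = (*)" "ring.add kxy = (+)" "ring.zero kxy = 0"
  by (auto simp: kxy_def ring_of_type_algebra_def)

text \<open>Additive inverses come from multiplication by \<open>- 1\<close>, so closure under sums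
  and multiples suffices. Concrete ideals can then be checked on coefficients.\<close>

lemma ideal_kxy_iff:
  "ideal J kxy \<longleftrightarrow> 0 \<in> J \<and> (\<forall>f\<in>J. \<forall>g\<in>J. f + g \<in> J) \<and> (\<forall>f\<in>J. \<forall>g. g * f \<in> J)"
proof
  assume "ideal J kxy"
  then interpret ideal J kxy .
  show "0 \<in> J \<and> (\<forall>f\<in>J. \<forall>g\<in>J. f + g \<in> J) \<and> (\<forall>f\<in>J. \<forall>g. g * f \<in> J)"
    using additive_subgroup.zero_closed[OF is_additive_subgroup]
      additive_subgroup.a_closed[OF is_additive_subgroup] I_l_closed by simp
next
  assume J: "0 \<in> J \<and> (\<forall>f\<in>J. \<forall>g\<in>J. f + g \<in> J) \<and> (\<forall>f\<in>J. \<forall>g. g * f \<in> J)"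
  interpret ring kxy by (rule ring_kxy)
  show "ideal J kxy"
  proof (rule idealI[OF ring_kxy])
    show "subgroup J (add_monoid kxy)"
    proof (rule add.subgroupI)
      fix f assume f: "f \<in> J"
      have "\<ominus>\<^bsub>kxy\<^esub> f = - 1 * f"
        using r_neg[of f] by (simp add: add_eq_0_iff)
      then show "\<ominus>\<^bsub>kxy\<^esub> f \<in> J"
        using J f by metis
    qed (use J in auto)
    show "g \<otimes>\<^bsub>kxy\<^esub> f \<in> J" "f \<otimes>\<^bsub>kxy\<^esub> g \<in> J" if "f \<in> J" for f g
      using J that by (auto simp: mult.commute[of f g])
  qed
qed

lemma ideal_kxy_add: "ideal J kxy \<Longrightarrow> f \<in> J \<Longrightarrow> g \<in> J \<Longrightarrow> f + g \<in> J"
  and ideal_kxy_mult: "ideal J kxy \<Longrightarrow> f \<in> J \<Longrightarrow> g * f \<in> J"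
  by (auto simp: ideal_kxy_iff)

lemma ideal_kxy_diff:
  assumes "ideal J kxy" "f \<in> J" "g \<in> J"
  shows "f - g \<in> J"
  using ideal_kxy_add[OF assms(1,2) ideal_kxy_mult[OF assms(1,3), of "- 1"]] by simp

lemma ideal_kxy_smult_iff:
  assumes "ideal J kxy" "a \<noteq> 0"
  shows "[:[:a:]:] * f \<in> J \<longleftrightarrow> f \<in> J"
proof
  assume "[:[:a:]:] * f \<in> J"
  then have "[:[:inverse a:]:] * ([:[:a:]:] * f) \<in> J"
    by (rule ideal_kxy_mult[OF assms(1)])
  then show "f \<in> J"
    using assms(2) by (simp add: pCons_one)
qed (rule ideal_kxy_mult[OF assms(1)])

text \<open>The coefficient of \<open>x^i y^j\<close>: the indices swap because \<open>y\<close> is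
  the outer variable.\<close>

definition mcoeff :: "'a::field poly poly \<Rightarrow> nat \<Rightarrow> nat \<Rightarrow> 'a"
  where "mcoeff f i j = coeff (coeff f j) i"

lemma mcoeff_simps [simp]:
  "mcoeff 0 i j = 0"
  "mcoeff (f + g) i j = mcoeff f i j + mcoeff g i j"
  "mcoeff (f - g) i j = mcoeff f i j - mcoeff g i j"
  "mcoeff (smult [:a:] f) i j = a * mcoeff f i j"
  by (auto simp: mcoeff_def)

lemma mcoeff_mult:
  "mcoeff (f * g) i j = (\<Sum>l\<le>j. \<Sum>k\<le>i. mcoeff f k l * mcoeff g (i - k) (j - l))"
  by (simp add: mcoeff_def coeff_mult coeff_sum)

lemma var_power_eq_monom:
  "var_x ^ p = monom (monom (1::'a::field) p) 0" "var_y ^ q = monom (1::'a poly) q"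
proof -
  have x: "var_x = monom (monom (1::'a) 1) 0" and y: "var_y = monom (1::'a poly) 1"
    by (simp_all add: var_x_def var_y_def monom_altdef one_pCons)
  show "var_x ^ p = monom (monom (1::'a) p) 0"
    unfolding x by (simp only: monom_power) simp
  show "var_y ^ q = monom (1::'a poly) q"
    unfolding y by (simp only: monom_power) simp
qed

lemma mcoeff_var_power_mult [simp]:
  "mcoeff (var_x ^ p * f) i j = (if i < p then 0 else mcoeff f (i - p) j)"
  "mcoeff (var_y ^ q * f) i j = (if j < q then 0 else mcoeff f i (j - q))"
  by (auto simp: var_power_eq_monom mcoeff_def coeff_monom_mult)

lemma mcoeff_var_power [simp]:
  "mcoeff (var_x ^ p) i j = of_bool (i = p \<and> j = 0)"
  "mcoeff (var_y ^ q) i j = of_bool (i = 0 \<and> j = q)"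
  by (auto simp: var_power_eq_monom mcoeff_def)

lemmas mcoeff_var [simp] =
  mcoeff_var_power_mult(1)[of 1, simplified power_one_right]
  mcoeff_var_power_mult(2)[of 1, simplified power_one_right]
  mcoeff_var_power(1)[of 1, simplified power_one_right]
  mcoeff_var_power(2)[of 1, simplified power_one_right]

text \<open>The ideal \<open>I + <x^2y>\<close>, which is the cube of \<open><x, y>\<close>.\<close>

definition order_ge_3 :: "'a::field poly poly set"
  where "order_ge_3 = {f. mcoeff f 0 0 = 0 \<and> mcoeff f 1 0 = 0 \<and> mcoeff f 0 1 = 0 \<and>
    mcoeff f 2 0 = 0 \<and> mcoeff f 1 1 = 0 \<and> mcoeff f 0 2 = 0}"

text \<open>This is the ideal \<open>I + \<langle>x\<^sup>2 - xy + y\<^sup>2\<rangle>\<close>.\<close>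

definition witness_ideal :: "'a::field poly poly set"
  where "witness_ideal = {f. mcoeff f 0 0 = 0 \<and> mcoeff f 1 0 = 0 \<and> mcoeff f 0 1 = 0 \<and>
    mcoeff f 2 0 = - mcoeff f 1 1 \<and> mcoeff f 0 2 = - mcoeff f 1 1 \<and> mcoeff f 2 1 = - mcoeff f 1 2}"

lemma ideal_order_ge_3: "ideal order_ge_3 kxy"
  unfolding ideal_kxy_iff order_ge_3_def by (auto simp: mcoeff_mult numeral_2_eq_2)

text \<open>The condition in degree 3 survives because \<open>x\<close> and \<open>y\<close> times
  \<open>x^2 - xy + y^2\<close> both have opposite coefficients at \<open>x^2y\<close> and
  \<open>xy^2\<close>.\<close>

lemma ideal_witness_ideal: "ideal witness_ideal kxy"
  unfolding ideal_kxy_iff witness_ideal_def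
  by (auto simp: mcoeff_mult numeral_2_eq_2 algebra_simps)

abbreviation gens :: "'a::field poly poly set"
  where "gens \<equiv> {var_x ^ 2 * var_y - var_x * var_y ^ 2, var_x ^ 3, var_y ^ 3}"

lemma gens_subset: "gens \<subseteq> order_ge_3 \<inter> witness_ideal"
  by (auto simp: order_ge_3_def witness_ideal_def)

text \<open>Writes \<open>f\<close> in terms of the generators. With \<open>J\<close> any ideal
  above them, this serves both for \<open>I\<close> itself and for the binomial ideals.\<close>

lemma mem_idealI:
  assumes J: "ideal J kxy" and gens: "gens \<subseteq> J" and f: "f \<in> order_ge_3" "f \<in> witness_ideal"
  shows "f \<in> J"
proof -
  obtain p0 p1 p2 g where f_eq: "f = pCons p0 (pCons p1 (pCons p2 g))"
    by (metis pCons_cases)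
  obtain a0 a1 a2 q0 where p0: "p0 = pCons a0 (pCons a1 (pCons a2 q0))"
    by (metis pCons_cases)
  obtain b0 b1 b2 q1 where p1: "p1 = pCons b0 (pCons b1 (pCons b2 q1))"
    by (metis pCons_cases)
  \<comment> \<open>Splitting off two coefficients is enough here, since \<open>x^2y^2\<close>
    already lies in \<open>I\<close>.\<close>
  obtain c0 c1 q2 where p2: "p2 = pCons c0 (pCons c1 q2)"
    by (metis pCons_cases)
  have z: "a0 = 0" "a1 = 0" "a2 = 0" "b0 = 0" "b1 = 0" "c0 = 0" "c1 = - b2"
    using f unfolding order_ge_3_def witness_ideal_def f_eq p0 p1 p2
    by (auto simp: mcoeff_def numeral_2_eq_2)
  have "f = ([:q0:] + [:q1:] * var_y) * var_x ^ 3 + g * var_y ^ 3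
    + [:[:b2:]:] * (var_x ^ 2 * var_y - var_x * var_y ^ 2)
    + [:q2:] * (var_x ^ 2 * var_y ^ 2)"
    unfolding f_eq p0 p1 p2 z var_x_def var_y_def
    by (simp add: power2_eq_square power3_eq_cube)
  also have "var_x ^ 2 * var_y ^ 2 =
      var_y * (var_x ^ 2 * var_y - var_x * var_y ^ 2) + var_x * (var_y ^ 3 :: 'a poly poly)"
    by (simp add: power2_eq_square power3_eq_cube algebra_simps)
  finally show ?thesis
    using gens by (simp only:) (intro ideal_kxy_add[OF J] ideal_kxy_mult[OF J]; blast)
qed

lemma genideal_gens: "Idl\<^bsub>kxy\<^esub> gens = order_ge_3 \<inter> witness_ideal"
proof
  interpret ring kxy by (rule ring_kxy)
  show "Idl\<^bsub>kxy\<^esub> gens \<subseteq> order_ge_3 \<inter> witness_ideal"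
    by (intro genideal_minimal i_intersect ideal_order_ge_3 ideal_witness_ideal gens_subset)
  show "order_ge_3 \<inter> witness_ideal \<subseteq> Idl\<^bsub>kxy\<^esub> gens"
    using mem_idealI[OF genideal_ideal genideal_self] by auto
qed

lemma not_irreducible_ideal_gens:
  "\<not> irreducible_ideal kxy (order_ge_3 \<inter> witness_ideal :: 'a::field poly poly set)"
proof -
  let ?w = "var_x ^ 2 - var_x * var_y + var_y ^ 2 :: 'a poly poly"
  have "var_x ^ 2 * var_y \<in> order_ge_3 - (witness_ideal :: 'a poly poly set)"
    and "?w \<in> witness_ideal - order_ge_3"
    by (auto simp: order_ge_3_def witness_ideal_def)
  then have "order_ge_3 \<inter> witness_ideal \<subset> (order_ge_3 :: 'a poly poly set)"
    and "order_ge_3 \<inter> witness_ideal \<subset> (witness_ideal :: 'a poly poly set)"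
    by blast+
  then show ?thesis
    unfolding irreducible_ideal_def using ideal_order_ge_3 ideal_witness_ideal by blast
qed

lemma binomial_mem_order_ge_3:
  fixes J :: "'a::field poly poly set"
  assumes J: "ideal J kxy" and gens: "gens \<subseteq> J" and s: "var_x ^ 2 * var_y \<notin> J"
    and b: "b \<in> J" "b \<in> binomials"
  shows "b \<in> order_ge_3"
proof -
  \<comment> \<open>The product is congruent to \<open>a * x^2y\<close> modulo \<open>I\<close>, so
    \<open>a * x^2y\<close> lies in \<open>J\<close>. As \<open>x^2y\<close> and \<open>xy^2\<close>
    agree modulo \<open>I\<close>, each \<open>a\<close> below is the sum of the product's
    coefficients at these two monomials.\<close>
  have reduce: "a = 0"
    if "var_x ^ p * var_y ^ q * b - [:[:a:]:] * (var_x ^ 2 * var_y) \<in> order_ge_3 \<inter> witness_ideal"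
    for p q a
  proof (rule ccontr)
    assume "a \<noteq> 0"
    have "var_x ^ p * var_y ^ q * b
        - (var_x ^ p * var_y ^ q * b - [:[:a:]:] * (var_x ^ 2 * var_y)) \<in> J"
      using that by (intro ideal_kxy_diff[OF J] ideal_kxy_mult[OF J] b mem_idealI[OF J gens]) auto
    then show False
      using s ideal_kxy_smult_iff[OF J \<open>a \<noteq> 0\<close>] by simp
  qed
  note defs = order_ge_3_def witness_ideal_def
  \<comment> \<open>The degree of the multiplier goes down; the coefficients already known to vanish
    keep each product in \<open>order_ge_3\<close>.\<close>
  have b00: "mcoeff b 0 0 = 0"
    by (rule reduce[of 2 1]) (simp add: defs mult.assoc)
  have b1: "mcoeff b 1 0 + mcoeff b 0 1 = 0"
    by (rule reduce[of 1 1]) (simp add: defs mult.assoc b00)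
  have b01: "mcoeff b 0 1 = 0"
    by (rule reduce[of 2 0]) (simp add: defs mult.assoc b00)
  have b10: "mcoeff b 1 0 = 0"
    using b1 b01 by simp
  have b_x: "mcoeff b 1 1 + mcoeff b 0 2 = 0"
    by (rule reduce[of 1 0]) (use b00 b01 b10 in \<open>simp add: defs mult.assoc\<close>)
  have b_y: "mcoeff b 2 0 + mcoeff b 1 1 = 0"
    by (rule reduce[of 0 1]) (use b00 b01 b10 in \<open>simp add: defs mult.assoc\<close>)
  obtain i j k l c where "b = var_x ^ i * var_y ^ j - [:[:c:]:] * (var_x ^ k * var_y ^ l)"
    using b(2) unfolding binomials_def monomials_def by blast
  then have "mcoeff b u v = 0" if "(u, v) \<noteq> (i, j)" "(u, v) \<noteq> (k, l)" for u v
    using that by (auto simp: mult.assoc)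
  \<comment> \<open>Two monomials cannot occupy all three positions. By \<open>b_x\<close> and
    \<open>b_y\<close> the three coefficients agree up to sign, so one zero makes all
    vanish.\<close>
  then have "mcoeff b 2 0 = 0 \<or> mcoeff b 1 1 = 0 \<or> mcoeff b 0 2 = 0"
    by (metis prod.inject zero_neq_numeral zero_neq_one one_eq_numeral_iff)
  then show ?thesis
    using b00 b01 b10 b_x b_y by (auto simp: order_ge_3_def)
qed

lemma binomial_ideal_above_gens:
  fixes J :: "'a::field poly poly set"
  assumes "binomial_ideal J" and gens: "gens \<subseteq> J" and s: "var_x ^ 2 * var_y \<notin> J"
  shows "J = order_ge_3 \<inter> witness_ideal"
proof
  interpret ring "kxy :: 'a poly poly ring" by (rule ring_kxy)
  obtain B where B: "B \<subseteq> binomials" "J = Idl\<^bsub>kxy\<^esub> B"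
    using assms(1) unfolding binomial_ideal_def by blast
  have J: "ideal J kxy" and "B \<subseteq> J"
    using genideal_ideal genideal_self B(2) by auto
  then have "B \<subseteq> order_ge_3"
    using binomial_mem_order_ge_3[OF J gens s] B(1) by blast
  then have J_le: "J \<subseteq> order_ge_3"
    unfolding B(2) by (rule genideal_minimal[OF ideal_order_ge_3])
  show "J \<subseteq> order_ge_3 \<inter> witness_ideal"
  proof
    fix f assume f: "f \<in> J"
    \<comment> \<open>The class of \<open>f\<close> modulo \<open>I\<close> is
      \<open>a * x^2y\<close>, because \<open>xy^2\<close> is congruent to
      \<open>x^2y\<close>.\<close>
    define a where "a = mcoeff f 2 1 + mcoeff f 1 2"
    have "f - [:[:a:]:] * (var_x ^ 2 * var_y) \<in> J"
      using f J_le by (intro mem_idealI[OF J gens])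
        (auto simp: order_ge_3_def witness_ideal_def a_def)
    then have "[:[:a:]:] * (var_x ^ 2 * var_y) \<in> J"
      using ideal_kxy_diff[OF J f] by fastforce
    then have "a = 0"
      using s ideal_kxy_smult_iff[OF J] by blast
    then show "f \<in> order_ge_3 \<inter> witness_ideal"
      using f J_le by (auto simp: order_ge_3_def witness_ideal_def a_def add_eq_0_iff2)
  qed
  show "order_ge_3 \<inter> witness_ideal \<subseteq> J"
    using mem_idealI[OF J gens] by blast
qed

theorem theorem6p4:
  fixes I :: "'a::field poly poly set"
  assumes "I = Idl\<^bsub>kxy\<^esub> {var_x ^ 2 * var_y - var_x * var_y ^ 2, var_x ^ 3, var_y ^ 3}"
  shows "\<not> (\<exists>F. (\<forall>J\<in>F. binomial_ideal J \<and> irreducible_ideal kxy J) \<and> I = \<Inter>F)"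
proof
  assume "\<exists>F. (\<forall>J\<in>F. binomial_ideal J \<and> irreducible_ideal kxy J) \<and> I = \<Inter>F"
  then obtain F where F: "\<And>J. J \<in> F \<Longrightarrow> binomial_ideal J"
    "\<And>J. J \<in> F \<Longrightarrow> irreducible_ideal kxy J" "I = \<Inter>F"
    by blast
  have I: "I = order_ge_3 \<inter> witness_ideal"
    using assms genideal_gens by simp
  have "var_x ^ 2 * var_y \<notin> I"
    unfolding I by (simp add: witness_ideal_def)
  \<comment> \<open>An empty \<open>F\<close> is excluded too: its intersection would contain
    \<open>x^2y\<close>.\<close>
  then obtain J where J: "J \<in> F" "var_x ^ 2 * var_y \<notin> J"
    using F(3) by blast
  have "gens \<subseteq> J"
    using gens_subset I F(3) J(1) by blast
  then have "J = order_ge_3 \<inter> witness_ideal"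
    using binomial_ideal_above_gens F(1) J by blast
  then show False
    using F(2)[OF J(1)] not_irreducible_ideal_gens by blast
qed

end
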